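(* The maximal discrepancy $|f(x,S)-E(x,S)|$ of a single vertex $x$ in a time interval $S$ of length $T$ is $\Theta(T^{1/2})$. That is, there are absolute constants $C,c>0$ such that for every integer $T\ge 1$, the supremum of $$|f(x,S)-E(x,S)|$$ over all even or odd initial configurations of the Propp machine on $\mathbb{Z}$, all $x\in\mathbb{Z}$, and all time intervals $S\subseteq\mathbb{N}_0$ of length $T$ is at most $C\,T^{1/2}$ and at least $c\,T^{1/2}$.
   Context: $\mathbb{N}_0$ is the set of non-negative integers. A (time) interval of length $T$ in $\mathbb{N}_0$ is a set of $T$ consecutive non-negative integers. Propp machine on $\mathbb{Z}$: at each time $t\in\mathbb{N}_0$, each vertex $x\in\mathbb{Z}$ holds a number $f(x,t)\in\mathbb{N}_0$ of chips and an arrow $\mathrm{ARR}(x,t)\in\{-1,+1\}$ ($+1$ = right, $-1$ = left). The initial configuration (the values $f(x,0)$ and $\mathrm{ARR}(x,0)$, $x\in\mathbb{Z}$; infinitely many vertices may hold chips) determines all later configurations by $$f(x,t+1)=\tfrac12 f(x-1,t)+\tfrac12 f(x+1,t)+\tfrac12\mathrm{ARR}(x-1,t)\,(f(x-1,t)\bmod 2)-\tfrac12\mathrm{ARR}(x+1,t)\,(f(x+1,t)\bmod 2),$$ $$\mathrm{ARR}(x,t+1)=(-1)^{f(x,t)}\,\mathrm{ARR}(x,t).$$ A configuration is even if no chip is at an odd position, and odd if no chip is at an even position (arrows are unrestricted). $E(x,t)$ is the expected number of chips at $x$ after all chips of the initial configuration perform independent simple random walks for $t$ steps, i.e. $E(x,t)=\sum_{y\in\mathbb{Z}}f(y,0)\,H(x-y,t)$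 (a finite sum), where $H(z,t)=2^{-t}\binom{t}{(t+z)/2}$ if $t-z$ is even (which is $0$ if $|z|>t$) and $H(z,t)=0$ otherwise. For $x\in\mathbb{Z}$ and finite $S\subseteq\mathbb{N}_0$, $f(x,S):=\sum_{t\in S}f(x,t)$ and $E(x,S):=\sum_{t\in S}E(x,t)$. *)

theory Defs
  imports "HOL-Analysis.Analysis"
begin

definition arrow_config :: "(int \<Rightarrow> int) \<Rightarrow> bool" where
  "arrow_config a \<longleftrightarrow> (\<forall>x. a x \<in> {-1, 1})"

definition even_config :: "(int \<Rightarrow> nat) \<Rightarrow> bool" where
  "even_config f \<longleftrightarrow> (\<forall>x. odd x \<longrightarrow> f x = 0)"

definition odd_config :: "(int \<Rightarrow> nat) \<Rightarrow> bool" where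
  "odd_config f \<longleftrightarrow> (\<forall>x. even x \<longrightarrow> f x = 0)"

text \<open>
  The state of the Propp machine at vertex \<open>x\<close> and time \<open>t\<close>, started with \<open>f x\<close> chips and
  arrow \<open>a x\<close> at each vertex \<open>x\<close>. If the initial arrows are \<open>-1\<close> or \<open>1\<close>, the integer that
  is halved below is even and non-negative, so neither \<open>div\<close> nor \<open>nat\<close> truncates; see
  \<open>chips_recurrence\<close>.
\<close>

fun chips :: "(int \<Rightarrow> nat) \<Rightarrow> (int \<Rightarrow> int) \<Rightarrow> int \<Rightarrow> nat \<Rightarrow> nat"
  and arrow :: "(int \<Rightarrow> nat) \<Rightarrow> (int \<Rightarrow> int) \<Rightarrow> int \<Rightarrow> nat \<Rightarrow> int"
where
  "chips f a x 0 = f x"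
| "chips f a x (Suc t) =
     nat ((int (chips f a (x - 1) t) + int (chips f a (x + 1) t)
           + arrow f a (x - 1) t * int (chips f a (x - 1) t mod 2)
           - arrow f a (x + 1) t * int (chips f a (x + 1) t mod 2)) div 2)"
| "arrow f a x 0 = a x"
| "arrow f a x (Suc t) = (-1) ^ chips f a x t * arrow f a x t"

lemma arrow_values:
  assumes "arrow_config a"
  shows "arrow f a x t \<in> {-1, 1}"
proof (induction t)
  case 0
  then show ?case using assms by (simp add: arrow_config_def)
next
  case (Suc t)
  then show ?case by (cases "even (chips f a x t)") auto
qed

lemma chips_recurrence:
  assumes "arrow_config a"
  shows "real (chips f a x (Suc t)) =
    1/2 * real (chips f a (x - 1) t) + 1/2 * real (chips f a (x + 1) t)
    + 1/2 * of_int (arrow f a (x - 1) t) * real (chips f a (x - 1) t mod 2)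
    - 1/2 * of_int (arrow f a (x + 1) t) * real (chips f a (x + 1) t mod 2)"
proof -
  define m n where "m = chips f a (x - 1) t" and "n = chips f a (x + 1) t"
  define r s where "r = arrow f a (x - 1) t" and "s = arrow f a (x + 1) t"
  define k where "k = int m + int n + r * int (m mod 2) - s * int (n mod 2)"
  have rs: "r = -1 \<or> r = 1" "s = -1 \<or> s = 1"
    using arrow_values[OF assms] by (auto simp: r_def s_def)
  have "even (int m + r * int (m mod 2)) \<and> 0 \<le> int m + r * int (m mod 2)"
    using rs(1) by (cases "even m") (auto elim!: oddE)
  moreover have "even (int n - s * int (n mod 2)) \<and> 0 \<le> int n - s * int (n mod 2)"
    using rs(2) by (cases "even n") (auto elim!: oddE)
  moreover have k: "k = (int m + r * int (m mod 2)) + (int n - s * int (n mod 2))"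
    by (simp add: k_def)
  ultimately have "even k" "0 \<le> k" by auto
  then have "real (nat (k div 2)) = of_int k / 2"
    by (simp add: real_of_int_div)
  then show ?thesis
    by (simp add: k_def m_def n_def r_def s_def field_simps del: of_nat_mod)
qed

text \<open>The probability that a simple random walk of \<open>t\<close> steps on the integers has
  displacement \<open>z\<close>. The guard \<open>\<bar>z\<bar> \<le> int t\<close> is needed because \<open>nat\<close> sends negative integers
  to \<open>0\<close>.\<close>

definition walk_prob :: "int \<Rightarrow> nat \<Rightarrow> real" where
  "walk_prob z t =
     (if even (int t - z) \<and> \<bar>z\<bar> \<le> int t
      then real (t choose nat ((int t + z) div 2)) / 2 ^ t else 0)"

text \<open>The range of summation contains all \<open>y\<close> from which \<open>x\<close> can be reached in \<open>t\<close> steps;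
  see \<open>expected_chips_eq_infsum\<close>.\<close>

definition expected_chips :: "(int \<Rightarrow> nat) \<Rightarrow> int \<Rightarrow> nat \<Rightarrow> real" where
  "expected_chips f x t = (\<Sum>y = x - int t..x + int t. real (f y) * walk_prob (x - y) t)"

lemma expected_chips_eq_infsum:
  "expected_chips f x t = (\<Sum>\<^sub>\<infinity>y. real (f y) * walk_prob (x - y) t)"
proof -
  have "(\<Sum>\<^sub>\<infinity>y. real (f y) * walk_prob (x - y) t)
      = (\<Sum>\<^sub>\<infinity>y\<in>{x - int t..x + int t}. real (f y) * walk_prob (x - y) t)"
    by (rule infsum_cong_neutral) (auto simp: walk_prob_def)
  then show ?thesis by (simp add: expected_chips_def)
qed

definition discrepancy :: "(int \<Rightarrow> nat) \<Rightarrow> (int \<Rightarrow> int) \<Rightarrow> int \<Rightarrow> nat set \<Rightarrow> real" where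
  "discrepancy f a x S =
     \<bar>real (\<Sum>t\<in>S. chips f a x t) - (\<Sum>t\<in>S. expected_chips f x t)\<bar>"

definition time_interval :: "nat \<Rightarrow> nat set \<Rightarrow> bool" where
  "time_interval T S \<longleftrightarrow> (\<exists>s. S = {s..<s + T})"

text \<open>The supremum is taken in the extended reals, so that an upper bound on it does express
  boundedness.\<close>

definition max_discrepancy :: "nat \<Rightarrow> ereal" where
  "max_discrepancy T =
     Sup {ereal (discrepancy f a x S) | f a x S.
            arrow_config a \<and> (even_config f \<or> odd_config f) \<and> time_interval T S}"

end

theory Submission
  imports Defs
begin

text \<open>
  The difference between the machine and the random walk is created by the odd chips. Whenever a
  vertex \<open>y\<close> holds an odd number of chips at time \<open>s\<close>, one chip too many goes into the direction
  of the arrow; from then on everything evolves linearly. Hence \<open>f(x,t) - E(x,t)\<close> is a sum, over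
  all these events, of the sign of the arrow times the influence of one misdirected chip, which
  depends only on \<open>x - y\<close> and \<open>t - s\<close> (\<open>chips_minus_expected\<close>). By the reflection principle the
  influence at displacement \<open>z > 0\<close> after \<open>u\<close> steps is the probability that a walk from the
  origin first visits \<open>z\<close> at time \<open>u\<close>. It has total mass at most \<open>1\<close>, and along the times \<open>u\<close>
  of one parity it rises to a maximum \<open>O(1 / z\<^sup>2)\<close> and then falls.

  Upper bound. At a fixed vertex the arrow alternates from one odd event to the next. Summation by
  parts therefore bounds the total contribution of the vertex by the variation, in \<open>s\<close>, of the
  influence summed over the time window. Moving \<open>s\<close> by two changes the window sum only at its two
  ends, so the variation is at most \<open>4\<close>; on the other hand it is at most \<open>T\<close> times the
  variation of one unimodal influence sequence, which is \<open>O(T / z\<^sup>2)\<close> (\<open>window_variation_le\<close>). The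
  sum over all \<open>z\<close> of the smaller of \<open>4\<close> and \<open>O(T / z\<^sup>2)\<close> is \<open>O(\<surd>T)\<close>: about \<open>\<surd>T\<close> near
  vertices contribute \<open>O(1)\<close> each, and the tail of \<open>T / z\<^sup>2\<close> beyond \<open>\<surd>T\<close> is again \<open>O(\<surd>T)\<close>.

  Lower bound. A lone chip at the origin with all arrows pointing right runs to the right for ever,
  so the machine never puts a chip on the origin again, whereas the random walk is at the origin at
  time \<open>2 j\<close> with probability of order \<open>1 / \<surd>j\<close>. During \<open>T\<close> steps these probabilities add up to
  order \<open>\<surd>T\<close>.
\<close>

section \<open>The law of the simple random walk\<close>

lemma walk_prob_binomial: "walk_prob (2 * int k - int t) t = real (t choose k) / 2 ^ t"
proof (cases "k \<le> t")
  case True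
  then show ?thesis by (auto simp: walk_prob_def)
next
  case False
  then show ?thesis by (auto simp: walk_prob_def)
qed

lemma walk_prob_eq_0: "odd (int t - z) \<or> int t < \<bar>z\<bar> \<Longrightarrow> walk_prob z t = 0"
  by (auto simp: walk_prob_def)

lemma walk_prob_0: "walk_prob z 0 = (if z = 0 then 1 else 0)"
  by (auto simp: walk_prob_def)

lemma walk_prob_nonneg: "0 \<le> walk_prob z t"
  by (simp add: walk_prob_def)

text \<open>
  From this one-step recurrence and the initial values all further facts about the walk follow, so
  binomial coefficients do not occur after this lemma.
\<close>

lemma walk_prob_Suc: "walk_prob z (Suc t) = (walk_prob (z - 1) t + walk_prob (z + 1) t) / 2"
proof (cases "odd (int t + 1 - z) \<or> int t + 1 < \<bar>z\<bar>")
  case True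
  then show ?thesis by (subst (1 2 3) walk_prob_eq_0) auto
next
  case False
  then have "even (int t + 1 - z)" by blast
  then obtain m where m: "int t + 1 - z = 2 * m" by (rule evenE)
  define k where "k = nat (int t + 1 - m)"
  have z: "z = 2 * int k - int (Suc t)" using False m by (auto simp: k_def)
  show ?thesis
  proof (cases k)
    case 0
    have "walk_prob (z - 1) t = 0" by (rule walk_prob_eq_0) (use z 0 in auto)
    moreover have "walk_prob (z + 1) t = 1 / 2 ^ t"
      using walk_prob_binomial[of 0 t] z 0 by simp
    moreover have "walk_prob z (Suc t) = 1 / 2 ^ Suc t"
      using walk_prob_binomial[of 0 "Suc t"] z 0 by simp
    ultimately show ?thesis by simp
  next
    case (Suc j)
    have "z - 1 = 2 * int j - int t" "z + 1 = 2 * int (Suc j) - int t" using z Suc by simp_all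
    then have "walk_prob (z - 1) t = real (t choose j) / 2 ^ t"
      and "walk_prob (z + 1) t = real (t choose Suc j) / 2 ^ t"
      by (simp_all only: walk_prob_binomial)
    moreover have "walk_prob z (Suc t) = real (Suc t choose Suc j) / 2 ^ Suc t"
      using walk_prob_binomial[of "Suc j" "Suc t"] z Suc by simp
    ultimately show ?thesis by (simp add: add_divide_distrib mult.commute)
  qed
qed

lemma walk_prob_minus: "walk_prob (- z) t = walk_prob z t"
proof (induction t arbitrary: z)
  case 0
  then show ?case by (simp add: walk_prob_0)
next
  case (Suc t)
  have "- z - 1 = - (z + 1)" "- z + 1 = - (z - 1)" by simp_all
  then have "walk_prob (- z - 1) t = walk_prob (z + 1) t" "walk_prob (- z + 1) t = walk_prob (z - 1) t"
    using Suc.IH[of "z + 1"] Suc.IH[of "z - 1"] by metis+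
  then show ?case by (simp add: walk_prob_Suc)
qed

text \<open>
  This is the ratio of two consecutive binomial coefficients, stated without division and valid
  also where both sides vanish.
\<close>

lemma walk_prob_neighbours:
  "(real t + 1 - of_int z) * walk_prob (z - 1) t = (real t + 1 + of_int z) * walk_prob (z + 1) t"
proof (induction t arbitrary: z)
  case 0
  then show ?case by (simp add: walk_prob_0)
next
  case (Suc t)
  have a: "(real t + 2 - of_int z) * walk_prob (z - 2) t = (real t + of_int z) * walk_prob z t"
    using Suc[of "z - 1"] by (simp add: algebra_simps)
  have b: "(real t - of_int z) * walk_prob z t = (real t + 2 + of_int z) * walk_prob (z + 2) t"
    using Suc[of "z + 1"] by (simp add: algebra_simps)
  show ?case using a b by (simp add: walk_prob_Suc algebra_simps)
qed

lemma walk_prob_Suc_right: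
  "(real t + 1 - of_int z) * walk_prob z (Suc t) = (real t + 1) * walk_prob (z + 1) t"
  using walk_prob_neighbours[of t z] by (simp add: walk_prob_Suc algebra_simps)

lemma walk_prob_Suc_left:
  "(real t + 1 + of_int z) * walk_prob z (Suc t) = (real t + 1) * walk_prob (z - 1) t"
  using walk_prob_neighbours[of t z] by (simp add: walk_prob_Suc algebra_simps)

text \<open>
  The recurrence in time at a fixed place. It decides by its factors alone whether the
  probability grows or shrinks, and so yields both the decay of the return probability and the
  unimodality of the influence.
\<close>

lemma walk_prob_Suc_Suc:
  "((real t + 2)\<^sup>2 - (of_int z)\<^sup>2) * walk_prob z (t + 2) = (real t + 2) * (real t + 1) * walk_prob z t"
proof -
  have "((real t + 2)\<^sup>2 - (of_int z)\<^sup>2) * walk_prob z (t + 2)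
      = (real t + 2 + of_int z) * ((real t + 2 - of_int z) * walk_prob z (Suc (Suc t)))"
    by (simp add: power2_eq_square algebra_simps)
  also have "(real t + 2 - of_int z) * walk_prob z (Suc (Suc t))
      = (real t + 2) * walk_prob (z + 1) (Suc t)"
    using walk_prob_Suc_right[of "Suc t" z] by (simp add: algebra_simps)
  also have "(real t + 2 + of_int z) * ((real t + 2) * walk_prob (z + 1) (Suc t))
      = (real t + 2) * ((real t + 1 + of_int (z + 1)) * walk_prob (z + 1) (Suc t))"
    by (simp add: algebra_simps)
  also have "\<dots> = (real t + 2) * (real t + 1) * walk_prob z t"
    unfolding walk_prob_Suc_left by simp
  finally show ?thesis .
qed

lemma return_prob_step: "walk_prob 0 (t + 2) = (real t + 1) / (real t + 2) * walk_prob 0 t"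
proof -
  have "(real t + 2) * ((real t + 2) * walk_prob 0 (t + 2))
      = (real t + 2) * ((real t + 1) * walk_prob 0 t)"
    using walk_prob_Suc_Suc[of t 0] by (simp add: power2_eq_square mult.assoc)
  then have "(real t + 2) * walk_prob 0 (t + 2) = (real t + 1) * walk_prob 0 t"
    by (subst (asm) mult_cancel_left) linarith
  then show ?thesis by (simp add: nonzero_eq_divide_eq mult.commute del: add_2_eq_Suc')
qed

text \<open>
  The return probability is of order \<open>1 / \<surd>j\<close>. Squared, the bounds here and in
  \<open>return_prob_sq_ge\<close> are rational functions of \<open>j\<close>, chosen such that the two-step recurrence
  reduces the induction step to a polynomial inequality.
\<close>

lemma return_prob_sq_le: "(walk_prob 0 (2 * j))\<^sup>2 \<le> 1 / (2 * real j + 1)"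
proof (induction j)
  case 0
  then show ?case by (simp add: walk_prob_0)
next
  case (Suc j)
  let ?r = "2 * real j"
  have step: "walk_prob 0 (2 * Suc j) = (?r + 1) / (?r + 2) * walk_prob 0 (2 * j)"
    using return_prob_step[of "2 * j"] by simp
  have "(walk_prob 0 (2 * Suc j))\<^sup>2 = ((?r + 1) / (?r + 2))\<^sup>2 * (walk_prob 0 (2 * j))\<^sup>2"
    unfolding step by (rule power_mult_distrib)
  also have "\<dots> \<le> ((?r + 1) / (?r + 2))\<^sup>2 * (1 / (?r + 1))"
    by (intro mult_left_mono Suc) auto
  also have "\<dots> \<le> 1 / (?r + 3)"
  proof -
    have "(x / (x + 1))\<^sup>2 * (1 / x) \<le> 1 / (x + 2)" if "x > 0" for x :: real
    proof -
      have "(x / (x + 1))\<^sup>2 * (1 / x) = x / (x + 1)\<^sup>2"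
        using that by (simp add: power2_eq_square)
      also have "\<dots> \<le> 1 / (x + 2)"
        using that by (simp add: divide_simps) (simp add: power2_eq_square algebra_simps)
      finally show ?thesis .
    qed
    from this[of "?r + 1"] show ?thesis by (simp add: add.commute)
  qed
  finally show ?case by (simp add: algebra_simps)
qed

lemma return_prob_sq_ge: "1 \<le> j \<Longrightarrow> 1 / (4 * real j) \<le> (walk_prob 0 (2 * j))\<^sup>2"
proof (induction j rule: nat_induct_at_least)
  case base
  have "walk_prob 0 (2 * 1) = 1 / 2"
    using return_prob_step[of 0] by (simp add: walk_prob_0 numeral_2_eq_2)
  then show ?case by (subst \<open>walk_prob 0 (2 * 1) = 1 / 2\<close>) (simp add: power_divide)
next
  case (Suc j)
  let ?r = "2 * real j"
  have step: "walk_prob 0 (2 * Suc j) = (?r + 1) / (?r + 2) * walk_prob 0 (2 * j)"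
    using return_prob_step[of "2 * j"] by simp
  have r: "?r > 0" using Suc by simp
  have "1 / (2 * (?r + 2)) \<le> ((?r + 1) / (?r + 2))\<^sup>2 * (1 / (2 * ?r))"
    using r by (simp add: divide_simps) (simp add: power2_eq_square algebra_simps)
  also have "\<dots> \<le> ((?r + 1) / (?r + 2))\<^sup>2 * (walk_prob 0 (2 * j))\<^sup>2"
    using Suc by (intro mult_left_mono) auto
  also have "\<dots> = (walk_prob 0 (2 * Suc j))\<^sup>2"
    unfolding step by (rule power_mult_distrib[symmetric])
  finally show ?case by (simp add: algebra_simps)
qed

text \<open>
  On the places of one parity the distribution decreases with the distance from the origin, so the value at \<open>z\<close> is at most
  the one at \<open>0\<close> or \<open>1\<close>, according to parity; and the value at \<open>1\<close> is a return probability one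
  step later.
\<close>

lemma walk_prob_sq_le: "0 \<le> z \<Longrightarrow> (walk_prob z t)\<^sup>2 \<le> 1 / (real t + 1)"
proof (induction "nat z" arbitrary: z rule: less_induct)
  case less
  consider "z = 0" | "z = 1" | "z \<ge> 2" using less.prems by linarith
  then show ?case
  proof cases
    case 1
    show ?thesis
    proof (cases "even t")
      case True
      then show ?thesis using 1 return_prob_sq_le by (auto elim!: evenE)
    next
      case False
      then show ?thesis using 1 by (simp add: walk_prob_eq_0)
    qed
  next
    case 2
    show ?thesis
    proof (cases "even t")
      case True
      then show ?thesis using 2 by (simp add: walk_prob_eq_0)
    next
      case False
      then have "even (Suc t)" by simp
      then obtain j where j: "Suc t = 2 * j" by (rule evenE)
      have "walk_prob 1 t = walk_prob 0 (Suc t)"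
        using walk_prob_minus[of 1 t] by (simp add: walk_prob_Suc)
      then have "(walk_prob 1 t)\<^sup>2 \<le> 1 / (real (Suc t) + 1)"
        using return_prob_sq_le[of j] unfolding j by simp
      also have "\<dots> \<le> 1 / (real t + 1)" by (simp add: frac_le)
      finally show ?thesis using 2 by simp
    qed
  next
    case 3
    have "(real t + of_int z) * walk_prob z t = (real t + 2 - of_int z) * walk_prob (z - 2) t"
      using walk_prob_neighbours[of t "z - 1"] by (simp add: algebra_simps)
    also have "\<dots> \<le> (real t + of_int z) * walk_prob (z - 2) t"
      using 3 by (intro mult_right_mono walk_prob_nonneg) auto
    finally have "walk_prob z t \<le> walk_prob (z - 2) t"
      using 3 by (simp add: mult_le_cancel_left)
    then have "(walk_prob z t)\<^sup>2 \<le> (walk_prob (z - 2) t)\<^sup>2"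
      by (intro power_mono walk_prob_nonneg)
    also have "\<dots> \<le> 1 / (real t + 1)" using 3 by (intro less.hyps) auto
    finally show ?thesis .
  qed
qed

section \<open>The influence of a misdirected chip\<close>

text \<open>
  The effect after \<open>u\<close> steps, at displacement \<open>z\<close>, of sending a single chip right instead of to
  either side with probability one half. For \<open>z > 0\<close> this is the probability that a simple random
  walk first visits \<open>z\<close> at time \<open>u\<close>. The value \<open>0\<close> at \<open>u = 0\<close> says that a chip has no effect before
  it moves; as subtraction of natural numbers truncates, \<open>influence z (t - s)\<close> then vanishes
  whenever \<open>t \<le> s\<close>.
\<close>

fun influence :: "int \<Rightarrow> nat \<Rightarrow> real" where
  "influence z 0 = 0"
| "influence z (Suc u) = (walk_prob (z - 1) u - walk_prob (z + 1) u) / 2"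

lemma influence_1: "influence z (Suc 0) = (if z = 1 then 1/2 else if z = - 1 then - 1/2 else 0)"
  by (simp add: walk_prob_0)

lemma influence_Suc:
  "0 < u \<Longrightarrow> influence z (Suc u) = (influence (z - 1) u + influence (z + 1) u) / 2"
  by (cases u) (simp_all add: walk_prob_Suc add_divide_distrib diff_divide_distrib)

lemma influence_minus: "influence (- z) u = - influence z u"
proof (cases u)
  case (Suc v)
  have "- z - 1 = - (z + 1)" "- z + 1 = - (z - 1)" by simp_all
  then have "walk_prob (- z - 1) v = walk_prob (z + 1) v" "walk_prob (- z + 1) v = walk_prob (z - 1) v"
    using walk_prob_minus[of "z + 1" v] walk_prob_minus[of "z - 1" v] by metis+
  then show ?thesis using Suc by (simp add: minus_divide_left)
qed simp

lemma influence_zero: "influence 0 u = 0"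
  using influence_minus[of 0 u] by simp

lemma influence_nonneg: "0 \<le> z \<Longrightarrow> 0 \<le> influence z u"
proof (induction u arbitrary: z)
  case (Suc u)
  consider "z = 0" | "u = 0" | "z > 0" "u > 0" using Suc.prems by linarith
  then show ?case
  proof cases
    case 1
    then show ?thesis by (simp only: influence_zero order_refl)
  next
    case 2
    then show ?thesis using Suc.prems influence_1[of z] by auto
  next
    case 3
    then show ?thesis unfolding influence_Suc[OF 3(2)] by (simp add: Suc.IH)
  qed
qed simp

text \<open>
  First visits to \<open>z\<close> at different times are disjoint events. In terms of the recurrence, the partial
  sums at \<open>z\<close> are averages of the partial sums at \<open>z - 1\<close> and \<open>z + 1\<close>; at \<open>z = 1\<close> the left neighbour
  contributes nothing, which leaves room for the direct step of probability one half.
\<close>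

lemma sum_influence_le_1: "0 \<le> z \<Longrightarrow> (\<Sum>u<n. influence z u) \<le> 1"
proof (induction n arbitrary: z)
  case (Suc n)
  show ?case
  proof (cases "z = 0 \<or> n = 0")
    case True
    then show ?thesis by (auto simp: influence_zero)
  next
    case False
    then obtain m where n: "n = Suc m" by (cases n) auto
    have shift: "(\<Sum>u<m. influence w (Suc u)) = (\<Sum>u<n. influence w u)" for w
      unfolding n sum.lessThan_Suc_shift by simp
    have "(\<Sum>u<Suc n. influence z u) = influence z (Suc 0) + (\<Sum>u<m. influence z (Suc (Suc u)))"
      unfolding n sum.lessThan_Suc_shift by simp
    also have "(\<Sum>u<m. influence z (Suc (Suc u)))
        = (\<Sum>u<m. (influence (z - 1) (Suc u) + influence (z + 1) (Suc u)) / 2)"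
      by (intro sum.cong influence_Suc) auto
    also have "\<dots> = ((\<Sum>u<n. influence (z - 1) u) + (\<Sum>u<n. influence (z + 1) u)) / 2"
      by (simp only: sum_divide_distrib[symmetric] sum.distrib shift)
    finally have eq: "(\<Sum>u<Suc n. influence z u) = influence z (Suc 0)
        + ((\<Sum>u<n. influence (z - 1) u) + (\<Sum>u<n. influence (z + 1) u)) / 2" .
    have up: "(\<Sum>u<n. influence (z + 1) u) \<le> 1" using Suc.prems by (intro Suc.IH) auto
    show ?thesis
    proof (cases "z = 1")
      case True
      then show ?thesis using up unfolding eq by (simp only: influence_1) (simp add: influence_zero)
    next
      case z: False
      have "(\<Sum>u<n. influence (z - 1) u) \<le> 1" using Suc.prems False by (intro Suc.IH) auto
      then show ?thesis using up z Suc.prems unfolding eq by (simp only: influence_1) simp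
    qed
  qed
qed simp

text \<open>
  The ballot theorem (hitting-time theorem) for the simple random walk.
\<close>

lemma influence_eq_walk_prob: "real u * influence z u = of_int z * walk_prob z u"
proof (cases u)
  case 0
  then show ?thesis by (simp add: walk_prob_0)
next
  case (Suc t)
  have "(real t + 1) * (walk_prob (z - 1) t - walk_prob (z + 1) t)
      = of_int z * (walk_prob (z - 1) t + walk_prob (z + 1) t)"
    using walk_prob_neighbours[of t z] by (simp add: algebra_simps)
  then show ?thesis using Suc by (simp add: walk_prob_Suc add.commute)
qed

lemma influence_eq_0: "int u < \<bar>z\<bar> \<Longrightarrow> influence z u = 0"
proof (cases u)
  case (Suc v)
  assume "int u < \<bar>z\<bar>"
  then have "walk_prob (z - 1) v = 0" "walk_prob (z + 1) v = 0"
    using Suc by (auto intro!: walk_prob_eq_0)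
  then show ?thesis using Suc by simp
qed simp

text \<open>
  The two-step recurrence of \<open>walk_prob\<close>, transferred by the ballot theorem. Comparing the factors
  \<open>(u + 2)\<^sup>2 - z\<^sup>2\<close> and \<open>(u + 1) u\<close> shows that the influence rises as long as \<open>3 u + 4 \<le> z\<^sup>2\<close> and falls
  afterwards.
\<close>

lemma influence_step:
  "((real u + 2)\<^sup>2 - (of_int z)\<^sup>2) * influence z (u + 2) = (real u + 1) * real u * influence z u"
proof -
  let ?c = "(real u + 2)\<^sup>2 - (of_int z :: real)\<^sup>2"
  have "(real u + 2) * (?c * influence z (u + 2)) = ?c * (real (u + 2) * influence z (u + 2))"
    by (simp add: mult.left_commute add.commute)
  also have "\<dots> = of_int z * (?c * walk_prob z (u + 2))"
    unfolding influence_eq_walk_prob by (rule mult.left_commute)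
  also have "\<dots> = of_int z * ((real u + 2) * (real u + 1) * walk_prob z u)"
    unfolding walk_prob_Suc_Suc ..
  also have "\<dots> = (real u + 2) * (real u + 1) * (of_int z * walk_prob z u)"
    by (rule mult.left_commute)
  also have "\<dots> = (real u + 2) * ((real u + 1) * real u * influence z u)"
    unfolding influence_eq_walk_prob[symmetric] by (simp only: mult.assoc)
  finally show ?thesis
    by (subst (asm) mult_cancel_left) linarith
qed

text \<open>
  The alternative \<open>u = 0\<close> matters for \<open>z = 1\<close>, and it is trivial since the influence vanishes there.
  Together with \<open>influence_falling\<close> it covers every \<open>u\<close>.
\<close>

lemma influence_rising:
  assumes "0 < z" and "3 * int u + 4 \<le> z\<^sup>2 \<or> u = 0"
  shows "influence z u \<le> influence z (u + 2)"
proof (cases "int u < z")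
  case True
  then show ?thesis using assms influence_nonneg[of z "u + 2"] by (simp add: influence_eq_0)
next
  case False
  then have "(real_of_int z)\<^sup>2 \<le> (real u)\<^sup>2" and u: "0 < u"
    using assms by (auto intro!: power_mono simp: of_int_le_iff[symmetric] simp del: of_int_le_iff)
  then have pos: "0 < (real u + 2)\<^sup>2 - (real_of_int z)\<^sup>2"
    by (simp add: power2_eq_square algebra_simps)
  have "real_of_int (3 * int u + 4) \<le> real_of_int (z\<^sup>2)"
    using assms u by (subst of_int_le_iff) auto
  then have "(real u + 2)\<^sup>2 - (real_of_int z)\<^sup>2 \<le> (real u + 1) * real u"
    by (simp add: power2_eq_square algebra_simps)
  then have "((real u + 2)\<^sup>2 - (real_of_int z)\<^sup>2) * influence z u
      \<le> (real u + 1) * real u * influence z u"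
    using assms by (intro mult_right_mono influence_nonneg) auto
  then show ?thesis
    unfolding influence_step[symmetric] using pos by (subst (asm) mult_le_cancel_left_pos)
qed

lemma influence_falling:
  assumes "0 < z" and "z\<^sup>2 \<le> 3 * int u + 4" and "0 < u"
  shows "influence z (u + 2) \<le> influence z u"
proof -
  have "real_of_int (z\<^sup>2) \<le> real_of_int (3 * int u + 4)"
    using assms by (subst of_int_le_iff) auto
  then have "(real u + 1) * real u \<le> (real u + 2)\<^sup>2 - (real_of_int z)\<^sup>2"
    by (simp add: power2_eq_square algebra_simps)
  then have "(real u + 1) * real u * influence z (u + 2)
      \<le> ((real u + 2)\<^sup>2 - (real_of_int z)\<^sup>2) * influence z (u + 2)"
    using assms by (intro mult_right_mono influence_nonneg) auto
  then have "(real u + 1) * real u * influence z (u + 2) \<le> (real u + 1) * real u * influence z u"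
    unfolding influence_step .
  then show ?thesis using assms by (subst (asm) mult_le_cancel_left_pos) auto
qed

text \<open>
  Up to time \<open>z\<^sup>2 / 3\<close> the influence rises, so it suffices to look at later times, of order at least
  \<open>z\<^sup>2\<close>. There the ballot theorem and the bound \<open>1 / \<surd>u\<close> on the walk give
  \<open>z / u powr (3/2)\<close>, which is \<open>O(1 / z\<^sup>2)\<close>.
\<close>

lemma influence_le:
  assumes "0 < z"
  shows "influence z u \<le> 19 / (of_int z)\<^sup>2"
proof (induction "nat (z\<^sup>2) - 3 * u" arbitrary: u rule: less_induct)
  case less
  consider "u = 0" | "0 < u" "3 * int u + 4 \<le> z\<^sup>2" | "0 < u" "z\<^sup>2 < 3 * int u + 4" by linarith
  then show ?case
  proof cases
    case 1
    then show ?thesis by simp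
  next
    case 2
    then have "3 * u + 4 \<le> nat (z\<^sup>2)" by (subst le_nat_iff) auto
    have "influence z (u + 2) \<le> 19 / (of_int z)\<^sup>2"
    proof (rule less)
      have "3 * u + 4 \<le> m \<Longrightarrow> m - 3 * (u + 2) < m - 3 * u" for m :: nat by presburger
      then show "nat (z\<^sup>2) - 3 * (u + 2) < nat (z\<^sup>2) - 3 * u"
        using \<open>3 * u + 4 \<le> nat (z\<^sup>2)\<close> .
    qed
    then show ?thesis using influence_rising[OF assms, of u] 2 by linarith
  next
    case 3
    let ?z = "real_of_int z" and ?u = "real u"
    have z: "?z > 0" and u: "?u > 0" using assms 3 by auto
    \<comment> \<open>As \<open>u \<ge> 1\<close>, the summand \<open>4\<close> is absorbed by \<open>4 u\<close>. The resulting constant is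
        \<open>7 powr (3/2) < 19\<close>; squaring everything avoids the square roots.\<close>
    have "z\<^sup>2 \<le> 7 * int u" using 3 by linarith
    then have "real_of_int (z\<^sup>2) \<le> real_of_int (7 * int u)" by (subst of_int_le_iff)
    then have zu: "?z\<^sup>2 \<le> 7 * ?u" by simp
    have "influence z u = ?z / ?u * walk_prob z u"
      using influence_eq_walk_prob[of u z] u by (simp add: field_simps)
    then have "(influence z u)\<^sup>2 = ?z\<^sup>2 / ?u\<^sup>2 * (walk_prob z u)\<^sup>2"
      by (simp add: power_mult_distrib power_divide)
    also have "\<dots> \<le> ?z\<^sup>2 / ?u\<^sup>2 * (1 / (?u + 1))"
      using assms by (intro mult_left_mono walk_prob_sq_le) auto
    also have "\<dots> \<le> ?z\<^sup>2 / ?u ^ 2 * (1 / ?u)"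
      using u by (intro mult_left_mono frac_le) auto
    also have "\<dots> = ?z\<^sup>2 / ?u ^ 3" by (simp add: power2_eq_square power3_eq_cube)
    also have "\<dots> \<le> ?z\<^sup>2 / (?z\<^sup>2 / 7) ^ 3"
      using z u zu by (intro divide_left_mono power_mono mult_pos_pos) auto
    also have "\<dots> = 343 / ?z ^ 4"
    proof -
      have "y\<^sup>2 / (y\<^sup>2 / 7) ^ 3 = 343 / y ^ 4" if "y \<noteq> 0" for y :: real
        using that by (simp add: power_divide nonzero_divide_eq_eq nonzero_eq_divide_eq flip: power_mult power_add)
      then show ?thesis using z by simp
    qed
    also have "\<dots> \<le> 361 / ?z ^ 4" by (intro divide_right_mono) auto
    also have "\<dots> = (19 / ?z\<^sup>2)\<^sup>2"
      by (simp add: power_divide)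
    finally show ?thesis by (rule power2_le_imp_le) simp
  qed
qed

section \<open>Total variation\<close>

text \<open>
  Summation by parts. In the application \<open>A\<close> is the sequence of arrows at a vertex, so the factor
  \<open>(A k - A (Suc k)) / 2\<close> is the arrow if it turns after step \<open>k\<close>, and \<open>0\<close> if it stays.
\<close>

lemma alternating_sum_le_variation:
  fixes A G :: "nat \<Rightarrow> real"
  assumes "\<And>k. \<bar>A k\<bar> \<le> 1" and "G K = 0"
  shows "\<bar>\<Sum>k<K. (A k - A (Suc k)) / 2 * G k\<bar> \<le> (\<Sum>k<K. \<bar>G k - G (Suc k)\<bar>)"
proof -
  have abel: "(\<Sum>k<n. (A k - A (Suc k)) * G k)
      = A 0 * G 0 - A n * G n - (\<Sum>k<n. A (Suc k) * (G k - G (Suc k)))" for n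
    by (induction n) (simp_all add: algebra_simps)
  have tele: "G 0 = (\<Sum>k<K. G k - G (Suc k))"
    using assms(2) sum_lessThan_telescope'[of G K] by simp
  have "A 0 * G 0 = (\<Sum>k<K. A 0 * (G k - G (Suc k)))"
    by (subst tele) (rule sum_distrib_left)
  then have "\<bar>\<Sum>k<K. (A k - A (Suc k)) * G k\<bar>
      = \<bar>\<Sum>k<K. (A 0 - A (Suc k)) * (G k - G (Suc k))\<bar>"
    unfolding abel assms(2)
    by (simp only: left_diff_distrib sum_subtractf mult_zero_right diff_0_right)
  also have "\<dots> \<le> (\<Sum>k<K. \<bar>(A 0 - A (Suc k)) * (G k - G (Suc k))\<bar>)" by (rule sum_abs)
  also have "\<dots> \<le> (\<Sum>k<K. 2 * \<bar>G k - G (Suc k)\<bar>)"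
  proof (rule sum_mono)
    fix k
    have "\<bar>A 0 - A (Suc k)\<bar> \<le> 2" using assms(1)[of 0] assms(1)[of "Suc k"] by linarith
    then show "\<bar>(A 0 - A (Suc k)) * (G k - G (Suc k))\<bar> \<le> 2 * \<bar>G k - G (Suc k)\<bar>"
      unfolding abs_mult by (rule mult_right_mono) simp
  qed
  finally have "\<bar>\<Sum>k<K. (A k - A (Suc k)) * G k\<bar> \<le> 2 * (\<Sum>k<K. \<bar>G k - G (Suc k)\<bar>)"
    by (simp add: sum_distrib_left)
  moreover have "(\<Sum>k<K. (A k - A (Suc k)) / 2 * G k) = (\<Sum>k<K. (A k - A (Suc k)) * G k) / 2"
    by (simp add: sum_divide_distrib)
  ultimately show ?thesis by simp
qed

text \<open>
  A sequence that rises from at least \<open>0\<close> to at most \<open>M\<close> and then falls to at least \<open>0\<close> has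
  variation at most \<open>2 M\<close>. The predicate \<open>P\<close> marks the steps from the maximum on; a predicate
  instead of the position of the maximum also serves sequences without a descent.
\<close>

lemma unimodal_variation_le:
  fixes g :: "nat \<Rightarrow> real"
  assumes "\<And>k. 0 \<le> g k" "\<And>k. g k \<le> M" "\<And>k. P k \<Longrightarrow> P (Suc k)"
    and "\<And>k. \<not> P k \<Longrightarrow> g k \<le> g (Suc k)" "\<And>k. P k \<Longrightarrow> g (Suc k) \<le> g k"
  shows "(\<Sum>k<K. \<bar>g k - g (Suc k)\<bar>) \<le> 2 * M"
proof -
  \<comment> \<open>Before the maximum the variation is at most the present value \<open>g K\<close>, hence also at most
      \<open>2 M - g K\<close>; the latter bound survives every descent.\<close>
  have "((\<Sum>k<K. \<bar>g k - g (Suc k)\<bar>) \<le> g K \<or> P K) \<and> (\<Sum>k<K. \<bar>g k - g (Suc k)\<bar>) \<le> 2 * M - g K"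
  proof (induction K)
    case 0
    then show ?case using assms(1)[of 0] assms(2)[of 0] by simp
  next
    case (Suc K)
    show ?case
    proof (cases "P K")
      case True
      then show ?thesis using Suc assms(3,5)[of K] by auto
    next
      case False
      then show ?thesis using Suc assms(4)[of K] assms(2)[of "Suc K"] by auto
    qed
  qed
  then show ?thesis using assms(1)[of K] by linarith
qed

text \<open>
  The starting time increases with \<open>k\<close>, so the influence sequence is traversed backwards: its falling
  part is the rising part here. Once \<open>2 k\<close> exceeds \<open>v\<close> the truncated argument is \<open>0\<close>, and
  the influence stays at \<open>0\<close>.
\<close>

lemma influence_variation_le:
  assumes "0 < z"
  shows "(\<Sum>k<K. \<bar>influence z (v - 2 * k) - influence z (v - 2 * Suc k)\<bar>) \<le> 38 / (of_int z)\<^sup>2"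
proof -
  define P where "P k \<longleftrightarrow> 3 * int (v - 2 * Suc k) + 4 \<le> z\<^sup>2 \<or> v - 2 * Suc k = 0" for k
  have "(\<Sum>k<K. \<bar>influence z (v - 2 * k) - influence z (v - 2 * Suc k)\<bar>) \<le> 2 * (19 / (of_int z)\<^sup>2)"
  proof (rule unimodal_variation_le[where P = P])
    fix k
    show "P k \<Longrightarrow> P (Suc k)" unfolding P_def by (auto simp: of_nat_diff)
    show "influence z (v - 2 * k) \<le> influence z (v - 2 * Suc k)" if "\<not> P k"
    proof -
      have "v - 2 * k = (v - 2 * Suc k) + 2" using that by (auto simp: P_def)
      then show ?thesis using influence_falling[OF assms, of "v - 2 * Suc k"] that
        by (auto simp: P_def)
    qed
    show "influence z (v - 2 * Suc k) \<le> influence z (v - 2 * k)" if "P k"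
    proof (cases "v < 2 * Suc k")
      case True
      then show ?thesis using assms influence_nonneg[of z "v - 2 * k"] by simp
    next
      case False
      then have "v - 2 * k = (v - 2 * Suc k) + 2" by auto
      then show ?thesis using influence_rising[OF assms, of "v - 2 * Suc k"] that
        by (auto simp: P_def)
    qed
  qed (use assms influence_nonneg influence_le in auto)
  then show ?thesis by simp
qed

text \<open>
  The arguments \<open>v - 2 k\<close> are distinct until truncation makes them \<open>0\<close>, and \<open>g\<close> vanishes there.
\<close>

lemma sum_even_shifts_le:
  fixes g :: "nat \<Rightarrow> real"
  assumes "\<And>u. 0 \<le> g u" "g 0 = 0"
  shows "(\<Sum>k<K. g (v - 2 * k)) \<le> (\<Sum>u<Suc v. g u)"
proof -
  have "(\<Sum>k<K. g (v - 2 * k)) = (\<Sum>k\<in>{k. k < K \<and> 2 * k < v}. g (v - 2 * k))"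
  proof (rule sum.mono_neutral_right)
    show "\<forall>k\<in>{..<K} - {k. k < K \<and> 2 * k < v}. g (v - 2 * k) = 0"
    proof
      fix k assume "k \<in> {..<K} - {k. k < K \<and> 2 * k < v}"
      then have "v - 2 * k = 0" by auto
      then show "g (v - 2 * k) = 0" using assms(2) by simp
    qed
  qed auto
  also have "\<dots> = sum g ((\<lambda>k. v - 2 * k) ` {k. k < K \<and> 2 * k < v})"
    by (subst sum.reindex) (auto simp: inj_on_def)
  also have "\<dots> \<le> (\<Sum>u<Suc v. g u)"
    using assms(1) by (intro sum_mono2) auto
  finally show ?thesis .
qed

text \<open>
  Shifting the window by two changes its sum only by two terms at each end.
  Truncated subtraction is harmless, for it sends the corresponding arguments on both sides
  to \<open>0\<close>.
\<close>

lemma sum_window_shift: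
  fixes g :: "nat \<Rightarrow> real"
  shows "(\<Sum>t\<in>{b..<b + T}. g (t - s)) - (\<Sum>t\<in>{b..<b + T}. g (t - (s + 2)))
    = g (b + T - 1 - s) + g (b + T - 2 - s) - g (b - 1 - s) - g (b - 2 - s)"
proof (induction T)
  case (Suc T)
  have "b + T - (s + 2) = b + T - 2 - s" "b + Suc T - 1 - s = b + T - s" 
    "b + Suc T - 2 - s = b + T - 1 - s" by auto
  then show ?case using Suc by simp
qed simp

text \<open>
  The two estimates have different regimes: the first one is used for \<open>z\<close> up to about \<open>\<surd>T\<close>, where
  only the total mass of the influence counts, and the second one beyond, where the influence
  is small throughout.
\<close>

lemma window_variation_le:
  fixes b T p :: nat
  assumes "0 < z"
  defines "G \<equiv> \<lambda>k. \<Sum>t\<in>{b..<b + T}. influence z (t - (p + 2 * k))"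
  shows "(\<Sum>k<K. \<bar>G k - G (Suc k)\<bar>) \<le> 4"
    and "(\<Sum>k<K. \<bar>G k - G (Suc k)\<bar>) \<le> 38 * real T / (of_int z)\<^sup>2"
proof -
  let ?h = "influence z"
  have nonneg: "0 \<le> ?h u" for u using assms by (simp add: influence_nonneg)
  have le1: "(\<Sum>k<K. ?h (c - (p + 2 * k))) \<le> 1" for c
  proof -
    have "(\<Sum>k<K. ?h (c - p - 2 * k)) \<le> (\<Sum>u<Suc (c - p). ?h u)"
      by (rule sum_even_shifts_le) (use nonneg in auto)
    also have "\<dots> \<le> 1" using assms by (intro sum_influence_le_1) auto
    finally show ?thesis by simp
  qed
  have "\<bar>G k - G (Suc k)\<bar> \<le> ?h (b + T - 1 - (p + 2 * k)) + ?h (b + T - 2 - (p + 2 * k))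
      + ?h (b - 1 - (p + 2 * k)) + ?h (b - 2 - (p + 2 * k))" for k
  proof -
    have next_start: "p + 2 * Suc k = (p + 2 * k) + 2" by simp
    have "\<bar>c + d - c' - d'\<bar> \<le> c + d + c' + d'"
      if "0 \<le> c" "0 \<le> d" "0 \<le> c'" "0 \<le> d'" for c d c' d' :: real
      using that by linarith
    then show ?thesis
      unfolding G_def next_start sum_window_shift using nonneg by blast
  qed
  then have "(\<Sum>k<K. \<bar>G k - G (Suc k)\<bar>)
      \<le> (\<Sum>k<K. ?h (b + T - 1 - (p + 2 * k)) + ?h (b + T - 2 - (p + 2 * k))
      + ?h (b - 1 - (p + 2 * k)) + ?h (b - 2 - (p + 2 * k)))"
    by (intro sum_mono)
  also have "\<dots> \<le> 1 + 1 + 1 + 1"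
    unfolding sum.distrib by (intro add_mono le1)
  finally show "(\<Sum>k<K. \<bar>G k - G (Suc k)\<bar>) \<le> 4" by simp
  have "(\<Sum>k<K. \<bar>G k - G (Suc k)\<bar>)
      \<le> (\<Sum>k<K. \<Sum>t\<in>{b..<b + T}. \<bar>?h (t - p - 2 * k) - ?h (t - p - 2 * Suc k)\<bar>)"
    unfolding G_def by (intro sum_mono) (simp add: sum_subtractf[symmetric] sum_abs)
  also have "\<dots> = (\<Sum>t\<in>{b..<b + T}. \<Sum>k<K. \<bar>?h (t - p - 2 * k) - ?h (t - p - 2 * Suc k)\<bar>)"
    by (rule sum.swap)
  also have "\<dots> \<le> (\<Sum>t\<in>{b..<b + T}. 38 / (of_int z)\<^sup>2)"
    by (intro sum_mono influence_variation_le assms)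
  finally show "(\<Sum>k<K. \<bar>G k - G (Suc k)\<bar>) \<le> 38 * real T / (of_int z)\<^sup>2"
    by (simp add: mult.commute)
qed

section \<open>The discrepancy as a sum of influences\<close>

text \<open>
  The number of chips sent right minus the number sent left: all chips but an odd last one
  are split evenly.
\<close>

definition net_flow :: "(int \<Rightarrow> nat) \<Rightarrow> (int \<Rightarrow> int) \<Rightarrow> int \<Rightarrow> nat \<Rightarrow> real" where
  "net_flow f a y s = of_int (arrow f a y s) * real (chips f a y s mod 2)"

lemma net_flow_eq_arrow_diff:
  "net_flow f a y s = (of_int (arrow f a y s) - of_int (arrow f a y (Suc s))) / 2"
  by (cases "even (chips f a y s)") (auto simp: net_flow_def odd_iff_mod_2_eq_one)

lemma expected_chips_superset:
  assumes "finite A" "{x - int t..x + int t} \<subseteq> A"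
  shows "expected_chips f x t = (\<Sum>y\<in>A. real (f y) * walk_prob (x - y) t)"
  unfolding expected_chips_def
  by (rule sum.mono_neutral_left) (use assms in \<open>auto simp: walk_prob_def\<close>)

lemma expected_chips_Suc:
  "expected_chips f x (Suc t) = (expected_chips f (x - 1) t + expected_chips f (x + 1) t) / 2"
proof -
  let ?A = "{x - int (Suc t)..x + int (Suc t)}"
  have "expected_chips f (x + 1) t = (\<Sum>y\<in>?A. real (f y) * walk_prob (x - y + 1) t)"
    by (subst expected_chips_superset[of ?A]) (auto simp: algebra_simps)
  moreover have "expected_chips f (x - 1) t = (\<Sum>y\<in>?A. real (f y) * walk_prob (x - y - 1) t)"
    by (subst expected_chips_superset[of ?A]) (auto simp: algebra_simps)
  moreover have "expected_chips f x (Suc t) = (\<Sum>y\<in>?A.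
      (real (f y) * walk_prob (x - y - 1) t + real (f y) * walk_prob (x - y + 1) t) / 2)"
    unfolding expected_chips_def
    by (intro sum.cong refl) (simp add: walk_prob_Suc distrib_left add_divide_distrib)
  ultimately show ?thesis
    by (simp only: sum.distrib sum_divide_distrib[symmetric])
qed

text \<open>
  Both sides satisfy the same recurrence in \<open>t\<close>: averaging over the two neighbours, plus half the
  net flow at time \<open>t\<close> out of the left neighbour, minus half the net flow out of the right
  one. The set \<open>A\<close> of vertices is kept independent of \<open>x\<close> and \<open>t\<close>, so that sums at different
  vertices and times range over the same set.
\<close>

lemma chips_minus_expected:
  assumes "arrow_config a" "finite A" "{x - int t..x + int t} \<subseteq> A"
  shows "real (chips f a x t) - expected_chips f x t
    = (\<Sum>s<t. \<Sum>y\<in>A. net_flow f a y s * influence (x - y) (t - s))"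
  using assms(3)
proof (induction t arbitrary: x)
  case 0
  then show ?case by (simp add: expected_chips_def walk_prob_0)
next
  case (Suc t)
  let ?d = "net_flow f a"
  let ?e = "\<lambda>x t. real (chips f a x t) - expected_chips f x t"
  have "{x - 1 - int t..x - 1 + int t} \<subseteq> A" "{x + 1 - int t..x + 1 + int t} \<subseteq> A"
    using Suc.prems by (auto intro!: subsetD[OF Suc.prems])
  note IH = this[THEN Suc.IH]
  have in_A: "x - 1 \<in> A" "x + 1 \<in> A" by (auto intro!: subsetD[OF Suc.prems])
  have "(\<Sum>y\<in>A. ?d y t * influence (x - y) (Suc 0))
      = (\<Sum>y\<in>{x - 1, x + 1}. ?d y t * influence (x - y) (Suc 0))"
    by (rule sum.mono_neutral_right) (use in_A assms in \<open>auto simp: influence_1 simp del: influence.simps(2)\<close>)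
  also have "\<dots> = (?d (x - 1) t - ?d (x + 1) t) / 2"
    by (simp add: influence_1 diff_divide_distrib del: influence.simps(2))
  finally have last: "(\<Sum>y\<in>A. ?d y t * influence (x - y) (Suc 0))
      = (?d (x - 1) t - ?d (x + 1) t) / 2" .
  have "(\<Sum>s<t. \<Sum>y\<in>A. ?d y s * influence (x - y) (Suc t - s))
      = (\<Sum>s<t. \<Sum>y\<in>A. (?d y s * influence (x - 1 - y) (t - s)
          + ?d y s * influence (x + 1 - y) (t - s)) / 2)"
  proof (intro sum.cong refl)
    fix s y assume "s \<in> {..<t}"
    then have "Suc t - s = Suc (t - s)" "0 < t - s" by auto
    then show "?d y s * influence (x - y) (Suc t - s) = (?d y s * influence (x - 1 - y) (t - s)
          + ?d y s * influence (x + 1 - y) (t - s)) / 2"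
      by (simp add: influence_Suc algebra_simps del: influence.simps(2))
  qed
  also have "\<dots> = (?e (x - 1) t + ?e (x + 1) t) / 2"
    unfolding IH by (simp add: sum.distrib sum_divide_distrib[symmetric])
  finally have "(\<Sum>s<t. \<Sum>y\<in>A. ?d y s * influence (x - y) (Suc t - s))
      = (?e (x - 1) t + ?e (x + 1) t) / 2" .
  moreover have "Suc t - t = Suc 0" by simp
  ultimately have "(\<Sum>s<Suc t. \<Sum>y\<in>A. ?d y s * influence (x - y) (Suc t - s))
      = (?e (x - 1) t + ?e (x + 1) t) / 2 + (?d (x - 1) t - ?d (x + 1) t) / 2"
    by (simp only: sum.lessThan_Suc last)
  moreover have "?e x (Suc t) = (?e (x - 1) t + ?e (x + 1) t) / 2 + (?d (x - 1) t - ?d (x + 1) t) / 2"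
    unfolding chips_recurrence[OF assms(1)] expected_chips_Suc net_flow_def
    by (simp add: field_simps)
  ultimately show ?case by simp
qed

lemma chips_parity:
  assumes "\<And>x. odd (x + q) \<Longrightarrow> f x = 0" and "odd (x + int t + q)"
  shows "chips f a x t = 0"
  using assms(2)
proof (induction t arbitrary: x)
  case 0
  then show ?case using assms(1) by simp
next
  case (Suc t)
  have "chips f a (x - 1) t = 0" "chips f a (x + 1) t = 0"
    using Suc.prems by (auto intro!: Suc.IH)
  then show ?case by simp
qed

lemma sum_lessThan_double:
  fixes g :: "nat \<Rightarrow> real"
  shows "(\<Sum>s<2 * K. g s) = (\<Sum>k<K. g (2 * k)) + (\<Sum>k<K. g (2 * k + 1))"
  by (induction K) auto

text \<open>
  As chips sit on a vertex \<open>y\<close> only at times of one parity, given by \<open>p\<close>, just these starting times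
  \<open>p + 2 k\<close> matter, and the arrow keeps its direction at all others. This is essential: the influence is zero
  at every other time, so its variation over all times would not be \<open>O(1 / z\<^sup>2)\<close>.
\<close>

lemma vertex_contribution_le:
  fixes y z :: int
  assumes a: "arrow_config a" and q: "\<And>x. odd (x + q) \<Longrightarrow> f x = 0"
    and K: "b + T \<le> 2 * K"
  defines "D \<equiv> \<bar>\<Sum>s<2 * K. net_flow f a y s * (\<Sum>t\<in>{b..<b + T}. influence z (t - s))\<bar>"
  shows "D \<le> (if z = 0 then 0 else min 4 (38 * real T / (of_int z)\<^sup>2))"
proof (cases "z = 0")
  case True
  then show ?thesis by (simp add: D_def influence_zero)
next
  case False
  define p :: nat where "p = (if even (y + q) then 0 else 1)"
  define G where "G w k = (\<Sum>t\<in>{b..<b + T}. influence w (t - (p + 2 * k)))" for w k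
  define A where "A k = real_of_int (arrow f a y (p + 2 * k))" for k
  have off: "chips f a y s = 0" if "odd (s + p)" for s
    using that by (intro chips_parity[OF q]) (auto simp: p_def split: if_splits)
  then have off_flow: "net_flow f a y s = 0" if "odd (s + p)" for s
    using that by (simp add: net_flow_def)
  have on_flow: "net_flow f a y (p + 2 * k) = (A k - A (Suc k)) / 2" for k
    using off[of "Suc (p + 2 * k)"] by (simp add: net_flow_eq_arrow_diff A_def)
  have "(\<Sum>s<2 * K. net_flow f a y s * (\<Sum>t\<in>{b..<b + T}. influence z (t - s)))
      = (\<Sum>k<K. net_flow f a y (p + 2 * k) * G z k)"
    unfolding sum_lessThan_double G_def
    by (cases "p = 0") (auto simp: off_flow p_def split: if_splits)
  then have D: "D = \<bar>\<Sum>k<K. (A k - A (Suc k)) / 2 * G z k\<bar>"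
    by (simp only: on_flow D_def)
  have G0: "G z K = 0"
    unfolding G_def using K by (intro sum.neutral) auto
  have "\<bar>A k\<bar> \<le> 1" for k
    using arrow_values[OF a, of f y "p + 2 * k"] by (auto simp: A_def)
  then have D_le: "D \<le> (\<Sum>k<K. \<bar>G z k - G z (Suc k)\<bar>)"
    unfolding D using G0 by (rule alternating_sum_le_variation)
  have neg: "G (- z) k = - G z k" for k
    by (simp add: G_def influence_minus sum_negf)
  have abs: "(\<Sum>k<K. \<bar>G z k - G z (Suc k)\<bar>) = (\<Sum>k<K. \<bar>G (abs z) k - G (abs z) (Suc k)\<bar>)"
    by (cases "0 \<le> z") (auto simp: neg intro!: sum.cong)
  have "D \<le> 4" "D \<le> 38 * real T / (of_int z)\<^sup>2"
    using D_le False window_variation_le[where z = "\<bar>z\<bar>" and K = K and b = b and T = T and p = p]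
    unfolding abs unfolding G_def by (auto simp del: sum.op_ivl_Suc)
  then show ?thesis using False by simp
qed

lemma sum_inverse_squares_le:
  assumes "1 \<le> L"
  shows "(\<Sum>z\<in>{L<..L + n}. 1 / (real z)\<^sup>2) \<le> 1 / real L - 1 / real (L + n)"
proof (induction n)
  case (Suc n)
  define m where "m = real (L + n)"
  have m: "m > 0" and m': "real (L + Suc n) = m + 1" using assms by (simp_all add: m_def)
  have "{L<..L + Suc n} = insert (L + Suc n) {L<..L + n}" by auto
  then have "(\<Sum>z\<in>{L<..L + Suc n}. 1 / (real z)\<^sup>2)
      = 1 / (m + 1)\<^sup>2 + (\<Sum>z\<in>{L<..L + n}. 1 / (real z)\<^sup>2)"
    by (simp add: m'[symmetric])
  moreover have "1 / (m + 1)\<^sup>2 \<le> 1 / (m * (m + 1))"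
    using m by (intro divide_left_mono) (auto simp: power2_eq_square)
  moreover have "1 / (m * (m + 1)) = 1 / m - 1 / (m + 1)"
    using m by (simp add: field_simps)
  ultimately show ?case using Suc unfolding m' m_def[symmetric] by linarith
qed simp

text \<open>
  The cut \<open>L\<close> is left free; the bound is best for \<open>L\<close> near \<open>\<surd>(B / A)\<close>, where the two branches
  of the minimum meet.
\<close>

lemma sum_min_inverse_square_le:
  fixes A B :: real
  assumes "1 \<le> L" "0 \<le> A" "0 \<le> B"
  shows "(\<Sum>z = 1..N. min A (B / (real z)\<^sup>2)) \<le> A * real L + B / real L"
proof -
  have "(\<Sum>z = 1..N. min A (B / (real z)\<^sup>2)) \<le> (\<Sum>z\<in>{1..L} \<union> {L<..L + N}. min A (B / (real z)\<^sup>2))"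
    using assms by (intro sum_mono2) auto
  also have "\<dots> = (\<Sum>z = 1..L. min A (B / (real z)\<^sup>2)) + (\<Sum>z\<in>{L<..L + N}. min A (B / (real z)\<^sup>2))"
    by (rule sum.union_disjoint) auto
  also have "(\<Sum>z = 1..L. min A (B / (real z)\<^sup>2)) \<le> (\<Sum>z = 1..L. A)"
    by (intro sum_mono) auto
  also have "(\<Sum>z\<in>{L<..L + N}. min A (B / (real z)\<^sup>2)) \<le> (\<Sum>z\<in>{L<..L + N}. B * (1 / (real z)\<^sup>2))"
    by (intro sum_mono) auto
  also have "\<dots> = B * (\<Sum>z\<in>{L<..L + N}. 1 / (real z)\<^sup>2)"
    by (rule sum_distrib_left[symmetric])
  also have "\<dots> \<le> B * (1 / real L)"
    using sum_inverse_squares_le[OF assms(1), of N] assms(3)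
    by (intro mult_left_mono) (auto intro: order_trans)
  finally show ?thesis by (simp add: mult.commute)
qed

lemma sum_symmetric_int:
  fixes w :: "int \<Rightarrow> real"
  assumes "w 0 = 0" "\<And>z. w (- z) = w z"
  shows "(\<Sum>z = - int N..int N. w z) = 2 * (\<Sum>z = 1..N. w (int z))"
proof (induction N)
  case 0
  then show ?case using assms by simp
next
  case (Suc N)
  have "{- int (Suc N)..int (Suc N)} = insert (- int (Suc N)) (insert (int (Suc N)) {- int N..int N})"
    by auto
  then have "(\<Sum>z = - int (Suc N)..int (Suc N). w z)
      = w (- int (Suc N)) + (w (int (Suc N)) + (\<Sum>z = - int N..int N. w z))"
    by simp
  then show ?case using Suc assms(2)[of "int (Suc N)"] by simp
qed

section \<open>The two bounds\<close>

text \<open>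
  The contributions of the vertices at distance up to about \<open>\<surd>T\<close> are bounded by \<open>4\<close> each, those of
  the vertices further away by \<open>38 T / z\<^sup>2\<close>. On each side of \<open>x\<close> this adds up to at most
  \<open>8 \<surd>T + 38 \<surd>T\<close>.
\<close>

lemma discrepancy_le:
  assumes a: "arrow_config a" and f: "even_config f \<or> odd_config f" and T: "1 \<le> T"
  shows "discrepancy f a x {b..<b + T} \<le> 92 * sqrt (real T)"
proof -
  \<comment> \<open>Any even number from \<open>b + T\<close> on will do: vertices further away, or starting times later, have no
      effect on \<open>x\<close> within the window.\<close>
  define N where "N = 2 * (b + T)"
  define A where "A = {x - int N..x + int N}"
  define S where "S = {b..<b + T}"
  define w :: "int \<Rightarrow> real" where
    "w z = (if z = 0 then 0 else min 4 (38 * real T / (of_int z)\<^sup>2))" for z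
  let ?d = "net_flow f a"
  obtain q where q: "\<And>x. odd (x + q) \<Longrightarrow> f x = 0"
  proof (cases "even_config f")
    case True
    then show ?thesis using that[of 0] by (auto simp: even_config_def)
  next
    case False
    then show ?thesis using that[of 1] f by (auto simp: odd_config_def)
  qed
  have "real (\<Sum>t\<in>S. chips f a x t) - (\<Sum>t\<in>S. expected_chips f x t)
      = (\<Sum>t\<in>S. real (chips f a x t) - expected_chips f x t)"
    by (simp add: sum_subtractf)
  also have "\<dots> = (\<Sum>t\<in>S. \<Sum>s<t. \<Sum>y\<in>A. ?d y s * influence (x - y) (t - s))"
    by (intro sum.cong refl chips_minus_expected a) (auto simp: A_def S_def N_def)
  also have "\<dots> = (\<Sum>t\<in>S. \<Sum>s<N. \<Sum>y\<in>A. ?d y s * influence (x - y) (t - s))"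
    by (intro sum.cong refl sum.mono_neutral_left) (auto simp: S_def N_def)
  also have "\<dots> = (\<Sum>s<N. \<Sum>t\<in>S. \<Sum>y\<in>A. ?d y s * influence (x - y) (t - s))"
    by (rule sum.swap)
  also have "\<dots> = (\<Sum>s<N. \<Sum>y\<in>A. \<Sum>t\<in>S. ?d y s * influence (x - y) (t - s))"
    by (intro sum.cong refl sum.swap)
  also have "\<dots> = (\<Sum>y\<in>A. \<Sum>s<N. \<Sum>t\<in>S. ?d y s * influence (x - y) (t - s))"
    by (rule sum.swap)
  also have "\<dots> = (\<Sum>y\<in>A. \<Sum>s<N. ?d y s * (\<Sum>t\<in>S. influence (x - y) (t - s)))"
    by (simp add: sum_distrib_left)
  finally have "discrepancy f a x S = \<bar>\<Sum>y\<in>A. \<Sum>s<N. ?d y s * (\<Sum>t\<in>S. influence (x - y) (t - s))\<bar>"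
    by (simp only: discrepancy_def)
  also have "\<dots> \<le> (\<Sum>y\<in>A. \<bar>\<Sum>s<N. ?d y s * (\<Sum>t\<in>S. influence (x - y) (t - s))\<bar>)"
    by (rule sum_abs)
  also have "\<dots> \<le> (\<Sum>y\<in>A. w (x - y))"
    unfolding N_def S_def w_def
    by (intro sum_mono vertex_contribution_le[OF a q]) auto
  also have "\<dots> = (\<Sum>z = - int N..int N. w z)"
    unfolding A_def
    by (rule sum.reindex_bij_witness[of _ "\<lambda>z. x - z" "\<lambda>y. x - y"]) auto
  also have "\<dots> = 2 * (\<Sum>z = 1..N. w (int z))"
    by (rule sum_symmetric_int) (auto simp: w_def)
  also have "(\<Sum>z = 1..N. w (int z)) = (\<Sum>z = 1..N. min 4 (38 * real T / (real z)\<^sup>2))"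
    by (intro sum.cong) (auto simp: w_def)
  finally have le: "discrepancy f a x S \<le> 2 * (\<Sum>z = 1..N. min 4 (38 * real T / (real z)\<^sup>2))"
    by simp
  define L where "L = nat \<lceil>sqrt (real T)\<rceil>"
  have T1: "1 \<le> sqrt (real T)" using T by simp
  then have L: "sqrt (real T) \<le> real L" "real L \<le> 2 * sqrt (real T)" "1 \<le> L"
    unfolding L_def by linarith+
  have "real T / real L \<le> real T / sqrt (real T)"
    using L T by (intro divide_left_mono mult_pos_pos) auto
  also have "\<dots> = sqrt (real T)" by (simp add: real_div_sqrt)
  finally have "38 * real T / real L \<le> 38 * sqrt (real T)" by simp
  moreover have "(\<Sum>z = 1..N. min 4 (38 * real T / (real z)\<^sup>2)) \<le> 4 * real L + 38 * real T / real L"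
    using L by (intro sum_min_inverse_square_le) auto
  ultimately show ?thesis using le L unfolding S_def by linarith
qed

lemma lone_chip:
  defines "f \<equiv> \<lambda>x. if x = 0 then 1 else 0" and "a \<equiv> \<lambda>x. 1"
  shows "chips f a x t = (if x = int t then 1 else 0) \<and>
    arrow f a x t = (if 0 \<le> x \<and> x < int t then - 1 else 1)"
proof (induction t arbitrary: x)
  case 0
  then show ?case by (simp add: f_def a_def)
next
  case (Suc t)
  then show ?case by auto
qed

lemma sum_return_prob_ge:
  assumes "1 \<le> T"
  shows "sqrt (real T) / 4 \<le> (\<Sum>t\<in>{2..<2 + T}. walk_prob 0 t)"
proof -
  define J where "J = {1..(T + 1) div 2}"
  have T: "real T > 0" using assms by simp
  have "walk_prob 0 (2 * j) \<ge> 1 / (2 * sqrt (real T))" if "j \<in> J" for j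
  proof -
    have j: "1 \<le> j" "j \<le> T" using that assms by (auto simp: J_def)
    have "(1 / (2 * sqrt (real T)))\<^sup>2 = 1 / (4 * real T)"
      using T by (simp add: power_divide power_mult_distrib)
    also have "\<dots> \<le> 1 / (4 * real j)" using j by (intro frac_le) auto
    also have "\<dots> \<le> (walk_prob 0 (2 * j))\<^sup>2" using j by (intro return_prob_sq_ge)
    finally show ?thesis by (rule power2_le_imp_le[OF _ walk_prob_nonneg])
  qed
  then have "(\<Sum>j\<in>J. 1 / (2 * sqrt (real T))) \<le> (\<Sum>j\<in>J. walk_prob 0 (2 * j))"
    by (intro sum_mono)
  also have "\<dots> = sum (walk_prob 0) ((*) 2 ` J)"
    by (subst sum.reindex) (auto simp: inj_on_def)
  also have "\<dots> \<le> (\<Sum>t\<in>{2..<2 + T}. walk_prob 0 t)"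
    by (intro sum_mono2 walk_prob_nonneg) (auto simp: J_def)
  finally have *: "real (card J) * (1 / (2 * sqrt (real T))) \<le> (\<Sum>t\<in>{2..<2 + T}. walk_prob 0 t)"
    by simp
  have "sqrt (real T) / 4 = real T / 2 * (1 / (2 * sqrt (real T)))"
    using T by (simp add: field_simps)
  also have "\<dots> \<le> real (card J) * (1 / (2 * sqrt (real T)))"
    by (intro mult_right_mono) (auto simp: J_def)
  finally show ?thesis using * by linarith
qed

text \<open>
  The window begins at time \<open>2\<close>, the first time after the start at which the walk can be at the
  origin, so that already \<open>T = 1\<close> gives a positive discrepancy.
\<close>

lemma discrepancy_ge:
  assumes "1 \<le> T"
  shows "sqrt (real T) / 4
    \<le> discrepancy (\<lambda>x. if x = 0 then 1 else 0) (\<lambda>x. 1) 0 {2..<2 + T}" (is "_ \<le> discrepancy ?f ?a 0 ?S")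
proof -
  have "(\<Sum>t\<in>?S. chips ?f ?a 0 t) = 0"
    by (intro sum.neutral) (simp add: lone_chip)
  moreover have "expected_chips ?f 0 t = walk_prob 0 t" for t
  proof -
    have "expected_chips ?f 0 t = (\<Sum>y\<in>{0}. real (?f y) * walk_prob (0 - y) t)"
      unfolding expected_chips_def by (rule sum.mono_neutral_right) auto
    then show ?thesis by simp
  qed
  ultimately show ?thesis
    using sum_return_prob_ge[OF assms] by (simp add: discrepancy_def)
qed

theorem theorem8:
  shows "\<exists>C c :: real. C > 0 \<and> c > 0 \<and>
    (\<forall>T\<ge>1. ereal (c * sqrt (real T)) \<le> max_discrepancy T \<and>
            max_discrepancy T \<le> ereal (C * sqrt (real T)))"
proof (intro exI conjI allI impI)
  show "(92 :: real) > 0" "(1 / 4 :: real) > 0" by simp_all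
  fix T :: nat assume T: "1 \<le> T"
  let ?f = "\<lambda>x :: int. if x = 0 then 1 else 0 :: nat" and ?a = "\<lambda>x :: int. 1 :: int"
  have "arrow_config ?a" "even_config ?f"
    by (auto simp: arrow_config_def even_config_def)
  moreover have "time_interval T {2..<2 + T}" unfolding time_interval_def by blast
  ultimately have "ereal (discrepancy ?f ?a 0 {2..<2 + T}) \<le> max_discrepancy T"
    unfolding max_discrepancy_def by (intro Sup_upper) blast
  moreover have "ereal (1 / 4 * sqrt (real T)) \<le> ereal (discrepancy ?f ?a 0 {2..<2 + T})"
    using discrepancy_ge[OF T] by simp
  ultimately show "ereal (1 / 4 * sqrt (real T)) \<le> max_discrepancy T"
    by (rule order_trans[rotated])
  show "max_discrepancy T \<le> ereal (92 * sqrt (real T))"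
    unfolding max_discrepancy_def
    by (rule Sup_least) (auto simp: time_interval_def intro!: discrepancy_le T)
qed

end
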